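(* For every integer $k\geq 1$, the graph $BC(k)$ is a proper disk graph.
   Context: $BC(1)$ is the graph with a single vertex, and for $k\geq 2$, $BC(k)$ is obtained from two disjoint copies of $BC(k-1)$ by adding one new vertex adjacent to all vertices of both copies. A proper disk graph is the intersection graph of a finite family of closed disks in the plane such that no disk of the family properly contains another disk of the family. *)

theory Defs
  imports "HOL-Analysis.Analysis"
begin

text \<open>Simple undirected graphs: a vertex set together with a set of two-element edges.\<close>

type_synonym 'a ugraph = "'a set \<times> 'a set set"

definition map_ugraph :: "('a \<Rightarrow> 'b) \<Rightarrow> 'a ugraph \<Rightarrow> 'b ugraph" where
  "map_ugraph f G = (f ` fst G, (\<lambda>e. f ` e) ` snd G)"

definition union_ugraph :: "'a ugraph \<Rightarrow> 'a ugraph \<Rightarrow> 'a ugraph" where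
  "union_ugraph G H = (fst G \<union> fst H, snd G \<union> snd H)"

definition add_universal :: "'a \<Rightarrow> 'a ugraph \<Rightarrow> 'a ugraph" where
  "add_universal x G = (insert x (fst G), snd G \<union> {{x, v} | v. v \<in> fst G})"

text \<open>
  Vertices are Boolean words. The two copies of the preceding graph are made disjoint by prefixing
  \<open>True\<close> and \<open>False\<close>, respectively, and the new vertex is the empty word.
  The value at \<open>0\<close> is a dummy.
\<close>

fun BC :: "nat \<Rightarrow> bool list ugraph" where
  "BC 0 = ({}, {})"
| "BC (Suc 0) = ({[]}, {})"
| "BC (Suc (Suc k)) =
     add_universal []
       (union_ugraph (map_ugraph ((#) True) (BC (Suc k))) (map_ugraph ((#) False) (BC (Suc k))))"

definition closed_disk :: "(real ^ 2) set \<Rightarrow> bool" where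
  "closed_disk D \<longleftrightarrow> (\<exists>c r. 0 < r \<and> D = cball c r)"

definition intersection_graph :: "'i set \<Rightarrow> ('i \<Rightarrow> 'p set) \<Rightarrow> 'i ugraph" where
  "intersection_graph I D = (I, {{i, j} | i j. i \<in> I \<and> j \<in> I \<and> i \<noteq> j \<and> D i \<inter> D j \<noteq> {}})"

text \<open>
  The family is indexed by the vertices of the graph, which accounts for graph isomorphism.
\<close>

definition proper_disk_graph :: "'a ugraph \<Rightarrow> bool" where
  "proper_disk_graph G \<longleftrightarrow>
     (\<exists>I D. finite I \<and> (\<forall>i\<in>I. closed_disk (D i)) \<and>
            (\<forall>i\<in>I. \<forall>j\<in>I. \<not> D i \<subset> D j) \<and>
            G = intersection_graph I D)"

end

theory Submission
  imports Defs
begin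

text \<open>
  Use disks that all touch the \<open>x\<close>-axis from above, at pairwise distinct points. None of them
  contains another, since each meets the axis only in its own point of tangency. The disks of
  radii \<open>r\<close> and \<open>s\<close> touching at \<open>p\<close> and \<open>q\<close> intersect iff \<open>(p - q)\<^sup>2 \<le> 4 r s\<close>. Hence translating
  one family far away realises a disjoint union, and a further disk of huge radius touching
  the axis anywhere else meets all the others.
\<close>

section \<open>Edge sets given by contact points and radii\<close>

definition tangent_edges :: "'a set \<Rightarrow> ('a \<Rightarrow> real) \<Rightarrow> ('a \<Rightarrow> real) \<Rightarrow> 'a set set" where
  "tangent_edges V p r =
     {{i, j} | i j. i \<in> V \<and> j \<in> V \<and> i \<noteq> j \<and> (p i - p j)\<^sup>2 \<le> 4 * r i * r j}"

text \<open>The disks are reduced to pairs of reals, so that the induction over \<open>BC\<close> is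
  free of geometry. Injectivity of \<open>p\<close> is what later rules out containment.\<close>

definition tangent_disk_graph :: "'a ugraph \<Rightarrow> bool" where
  "tangent_disk_graph G \<longleftrightarrow> finite (fst G) \<and>
     (\<exists>p r. inj_on p (fst G) \<and> (\<forall>i\<in>fst G. 0 < r i) \<and> snd G = tangent_edges (fst G) p r)"

lemma tangent_disk_graphI:
  assumes "finite V" "inj_on p V" "\<forall>i\<in>V. 0 < r i" "E = tangent_edges V p r"
  shows "tangent_disk_graph (V, E)"
  unfolding tangent_disk_graph_def fst_conv snd_conv using assms by blast

lemma tangent_edges_cong:
  assumes "\<And>i. i \<in> V \<Longrightarrow> p i = q i" "\<And>i. i \<in> V \<Longrightarrow> r i = s i"
  shows "tangent_edges V p r = tangent_edges V q s"
proof -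
  have "(p i - p j)\<^sup>2 \<le> 4 * r i * r j \<longleftrightarrow> (q i - q j)\<^sup>2 \<le> 4 * s i * s j"
    if "i \<in> V" "j \<in> V" for i j
    using that assms by simp
  then show ?thesis
    unfolding tangent_edges_def by blast
qed

lemma tangent_edges_translate: "tangent_edges V (\<lambda>i. p i + t) r = tangent_edges V p r"
  unfolding tangent_edges_def by simp

lemma tangent_edges_image:
  assumes "inj_on f V"
  shows "tangent_edges (f ` V) p r = (\<lambda>e. f ` e) ` tangent_edges V (p \<circ> f) (r \<circ> f)"
proof
  show "tangent_edges (f ` V) p r \<subseteq> (\<lambda>e. f ` e) ` tangent_edges V (p \<circ> f) (r \<circ> f)"
  proof
    fix e assume "e \<in> tangent_edges (f ` V) p r"
    then obtain i j where "i \<in> V" "j \<in> V" "f i \<noteq> f j" and e: "e = {f i, f j}"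
      and "(p (f i) - p (f j))\<^sup>2 \<le> 4 * r (f i) * r (f j)"
      unfolding tangent_edges_def by blast
    then have "{i, j} \<in> tangent_edges V (p \<circ> f) (r \<circ> f)"
      unfolding tangent_edges_def by auto
    then show "e \<in> (\<lambda>e. f ` e) ` tangent_edges V (p \<circ> f) (r \<circ> f)"
      by (rule rev_image_eqI) (simp add: e)
  qed
next
  show "(\<lambda>e. f ` e) ` tangent_edges V (p \<circ> f) (r \<circ> f) \<subseteq> tangent_edges (f ` V) p r"
  proof
    fix e assume "e \<in> (\<lambda>e. f ` e) ` tangent_edges V (p \<circ> f) (r \<circ> f)"
    then obtain i j where ij: "i \<in> V" "j \<in> V" "i \<noteq> j" and e: "e = {f i, f j}"
      and le: "(p (f i) - p (f j))\<^sup>2 \<le> 4 * r (f i) * r (f j)"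
      unfolding tangent_edges_def by auto
    \<comment> \<open>Injectivity keeps the image of an edge from collapsing to a singleton.\<close>
    from assms ij have "f i \<noteq> f j" by (meson inj_onD)
    with ij e le show "e \<in> tangent_edges (f ` V) p r"
      unfolding tangent_edges_def by blast
  qed
qed

lemma tangent_edges_Un:
  assumes "\<And>i j. i \<in> V \<Longrightarrow> j \<in> W \<Longrightarrow> 4 * r i * r j < (p i - p j)\<^sup>2"
  shows "tangent_edges (V \<union> W) p r = tangent_edges V p r \<union> tangent_edges W p r"
proof -
  \<comment> \<open>Both orders are stated, since the unordered pair of a mixed edge may be read
    with either end first.\<close>
  have "\<not> (p j - p i)\<^sup>2 \<le> 4 * r j * r i" "\<not> (p i - p j)\<^sup>2 \<le> 4 * r i * r j"
    if "i \<in> V" "j \<in> W" for i j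
    using assms[OF that] by (auto simp: power2_commute mult_ac)
  then show ?thesis
    unfolding tangent_edges_def by blast
qed

lemma tangent_edges_insert:
  assumes "x \<notin> V" "\<And>i. i \<in> V \<Longrightarrow> (p x - p i)\<^sup>2 \<le> 4 * r x * r i"
  shows "tangent_edges (insert x V) p r = tangent_edges V p r \<union> {{x, v} | v. v \<in> V}"
proof
  show "tangent_edges (insert x V) p r \<subseteq> tangent_edges V p r \<union> {{x, v} | v. v \<in> V}"
    unfolding tangent_edges_def by (auto simp: insert_commute)
  show "tangent_edges V p r \<union> {{x, v} | v. v \<in> V} \<subseteq> tangent_edges (insert x V) p r"
    unfolding tangent_edges_def using assms by blast
qed

text \<open>The bound is made positive so that it can serve as a radius, even for empty
  \<open>V\<close>.\<close>

lemma finite_real_bounded: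
  fixes f :: "'a \<Rightarrow> real"
  assumes "finite V"
  obtains M where "0 < M" "\<And>i. i \<in> V \<Longrightarrow> f i \<le> M"
proof -
  from assms have "bdd_above (f ` V)" by simp
  then obtain M where "\<forall>i\<in>V. f i \<le> M" unfolding bdd_above_def by auto
  then show thesis by (intro that[of "max 1 M"]) (auto simp: max.coboundedI2)
qed

section \<open>Closure under relabelling, disjoint union and adding a universal vertex\<close>

lemma tangent_disk_graph_map:
  assumes "tangent_disk_graph G" "inj f"
  shows "tangent_disk_graph (map_ugraph f G)"
proof -
  from assms(1) obtain p r where fin: "finite (fst G)" and p: "inj_on p (fst G)"
    and r: "\<forall>i\<in>fst G. 0 < r i" and E: "snd G = tangent_edges (fst G) p r"
    unfolding tangent_disk_graph_def by blast
  have inv: "p \<circ> inv f \<circ> f = p" "r \<circ> inv f \<circ> f = r"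
    using assms(2) by (auto simp: fun_eq_iff)
  have "inj_on (p \<circ> inv f) (f ` fst G)"
    using p assms(2) by (auto simp: inj_on_def)
  moreover have "\<forall>i\<in>f ` fst G. 0 < (r \<circ> inv f) i"
    using r assms(2) by simp
  moreover have "(\<lambda>e. f ` e) ` snd G = tangent_edges (f ` fst G) (p \<circ> inv f) (r \<circ> inv f)"
    using tangent_edges_image[OF inj_on_subset[OF assms(2) subset_UNIV]]
    by (simp add: E inv flip: comp_assoc)
  ultimately show ?thesis
    unfolding map_ugraph_def using fin by (intro tangent_disk_graphI) auto
qed

text \<open>Radii stay fixed and the contact points of \<open>H\<close> move right by
  \<open>t\<close>. This keeps the edges inside \<open>H\<close>, while a large \<open>t\<close>
  prevents edges between \<open>G\<close> and \<open>H\<close>.\<close>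

lemma tangent_disk_graph_union:
  assumes G: "tangent_disk_graph G" and H: "tangent_disk_graph H"
    and disj: "fst G \<inter> fst H = {}"
  shows "tangent_disk_graph (union_ugraph G H)"
proof -
  from G obtain p r where finG: "finite (fst G)" and p: "inj_on p (fst G)"
    and r: "\<forall>i\<in>fst G. 0 < r i" and EG: "snd G = tangent_edges (fst G) p r"
    unfolding tangent_disk_graph_def by blast
  from H obtain q s where finH: "finite (fst H)" and q: "inj_on q (fst H)"
    and s: "\<forall>i\<in>fst H. 0 < s i" and EH: "snd H = tangent_edges (fst H) q s"
    unfolding tangent_disk_graph_def by blast
  \<comment> \<open>\<open>A\<close> bounds the contact points of \<open>G\<close> from the right
    and \<open>-B\<close> those of \<open>H\<close> from the left; the same constants bound the
    radii.\<close>
  obtain A where A: "0 < A" "\<And>i. i \<in> fst G \<Longrightarrow> max (p i) (r i) \<le> A"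
    using finite_real_bounded[OF finG, of "\<lambda>i. max (p i) (r i)"] by blast
  obtain B where B: "0 < B" "\<And>i. i \<in> fst H \<Longrightarrow> max (- q i) (s i) \<le> B"
    using finite_real_bounded[OF finH, of "\<lambda>i. max (- q i) (s i)"] by blast
  \<comment> \<open>After the shift, mixed contact points are at least
    \<open>t - (A + B) = 2 * (A + B)\<close> apart, and the square of this exceeds
    \<open>4 * A * B\<close>.\<close>
  define t where "t = 3 * (A + B)"
  define p' where "p' i = (if i \<in> fst G then p i else q i + t)" for i
  define r' where "r' i = (if i \<in> fst G then r i else s i)" for i
  \<comment> \<open>The strict order gives injectivity of \<open>p'\<close> across the two parts;
    the inequality excludes mixed edges.\<close>
  have far: "p' i < p' j \<and> 4 * r' i * r' j < (p' i - p' j)\<^sup>2"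
    if ij: "i \<in> fst G" "j \<in> fst H" for i j
  proof -
    have pr: "p' i = p i" "r' i = r i" "p' j = q j + t" "r' j = s j"
      using ij disj by (auto simp: p'_def r'_def)
    have d: "2 * (A + B) \<le> p' j - p' i"
      using A(2)[OF ij(1)] B(2)[OF ij(2)] by (simp add: pr t_def)
    have "r i * s j \<le> A * B"
      using A B(2)[OF ij(2)] A(2)[OF ij(1)] r s ij by (intro mult_mono) auto
    also have "\<dots> < (A + B)\<^sup>2"
      using A(1) B(1) by (simp add: power2_eq_square algebra_simps add_pos_pos)
    finally have "4 * r' i * r' j < (2 * (A + B))\<^sup>2"
      by (simp add: pr power2_eq_square algebra_simps)
    also have "\<dots> \<le> (p' j - p' i)\<^sup>2"
      using d A(1) B(1) by (intro power_mono) auto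
    finally show ?thesis
      using d A(1) B(1) by (simp add: power2_commute)
  qed
  have "inj_on p' (fst G \<union> fst H)"
  proof (rule inj_onI)
    fix i j assume "i \<in> fst G \<union> fst H" "j \<in> fst G \<union> fst H" and eq: "p' i = p' j"
    then consider "i \<in> fst G" "j \<in> fst G" | "i \<in> fst H - fst G" "j \<in> fst H - fst G"
      using far[of i j] far[of j i] by fastforce
    then show "i = j"
      using eq p q by cases (auto simp: p'_def inj_on_def)
  qed
  moreover have "\<forall>i\<in>fst G \<union> fst H. 0 < r' i"
    using r s by (auto simp: r'_def)
  moreover have "snd G \<union> snd H = tangent_edges (fst G \<union> fst H) p' r'"
  proof -
    have "tangent_edges (fst G) p' r' = snd G"
      unfolding EG by (rule tangent_edges_cong) (auto simp: p'_def r'_def)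
    moreover have "tangent_edges (fst H) p' r' = tangent_edges (fst H) (\<lambda>i. q i + t) s"
      by (rule tangent_edges_cong) (use disj in \<open>auto simp: p'_def r'_def\<close>)
    ultimately show ?thesis
      using far by (simp add: tangent_edges_Un tangent_edges_translate EH)
  qed
  ultimately show ?thesis
    unfolding union_ugraph_def using finG finH by (intro tangent_disk_graphI) auto
qed

text \<open>With the contact point of the new disk fixed, enlarging its radius alone makes the edge
  condition true for each of the finitely many old disks.\<close>

lemma tangent_disk_graph_add_universal:
  assumes G: "tangent_disk_graph G" and x: "x \<notin> fst G"
  shows "tangent_disk_graph (add_universal x G)"
proof -
  from G obtain p r where fin: "finite (fst G)" and p: "inj_on p (fst G)"
    and r: "\<forall>i\<in>fst G. 0 < r i" and E: "snd G = tangent_edges (fst G) p r"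
    unfolding tangent_disk_graph_def by blast
  obtain a where a: "a \<notin> p ` fst G"
    using ex_new_if_finite[OF infinite_UNIV_char_0] fin by blast
  \<comment> \<open>Each quotient is the least radius with which a disk touching at \<open>a\<close>
    meets disk \<open>i\<close>.\<close>
  obtain R where R: "0 < R" "\<And>i. i \<in> fst G \<Longrightarrow> (a - p i)\<^sup>2 / (4 * r i) \<le> R"
    using finite_real_bounded[OF fin, of "\<lambda>i. (a - p i)\<^sup>2 / (4 * r i)"] by blast
  let ?p = "p(x := a)" and ?r = "r(x := R)"
  have "inj_on ?p (insert x (fst G))"
    using p a x by (auto simp: inj_on_def)
  moreover have "\<forall>i\<in>insert x (fst G). 0 < ?r i"
    using r R(1) by auto
  moreover have "tangent_edges (insert x (fst G)) ?p ?r = snd G \<union> {{x, v} | v. v \<in> fst G}"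
  proof -
    have "(?p x - ?p i)\<^sup>2 \<le> 4 * ?r x * ?r i" if "i \<in> fst G" for i
      using R(2)[OF that] r that x by (auto simp: field_simps)
    moreover have "tangent_edges (fst G) ?p ?r = snd G"
      unfolding E by (rule tangent_edges_cong) (use x in auto)
    ultimately show ?thesis
      using tangent_edges_insert[OF x, of ?p ?r] by simp
  qed
  ultimately show ?thesis
    unfolding add_universal_def using fin
    by (intro tangent_disk_graphI[where p = ?p and r = ?r]) simp_all
qed

lemma tangent_disk_graph_BC: "tangent_disk_graph (BC k)"
proof (induction k rule: BC.induct)
  case 1
  show ?case by (simp add: tangent_disk_graph_def tangent_edges_def)
next
  case 2
  show ?case
    by (auto simp: tangent_disk_graph_def tangent_edges_def intro!: exI[of _ "\<lambda>_. 1"])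
next
  case (3 k)
  show ?case
    unfolding BC.simps
    by (intro tangent_disk_graph_add_universal tangent_disk_graph_union
          tangent_disk_graph_map 3)
       \<comment> \<open>The copies are disjoint because their words begin with different letters,
         and \<open>[]\<close> lies in neither because it has no first letter.\<close>
       (auto simp: map_ugraph_def union_ugraph_def)
qed

section \<open>Plane geometry of disks tangent to the axis\<close>

lemma cball_Int_cball_nonempty_iff:
  fixes a b :: "'a::real_normed_vector"
  assumes "0 \<le> r" "0 \<le> s"
  shows "cball a r \<inter> cball b s \<noteq> {} \<longleftrightarrow> dist a b \<le> r + s"
proof
  assume "cball a r \<inter> cball b s \<noteq> {}"
  then obtain z where "dist a z \<le> r" "dist b z \<le> s" by auto
  then show "dist a b \<le> r + s"
    using dist_triangle2[of a b z] by linarith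
next
  assume le: "dist a b \<le> r + s"
  show "cball a r \<inter> cball b s \<noteq> {}"
  \<comment> \<open>Two balls of radius zero are split off, since the witness below divides by
    \<open>r + s\<close>.\<close>
  proof (cases "r + s = 0")
    case True
    with assms le have "a = b" "r = 0" "s = 0" by auto
    then show ?thesis by simp
  next
    case False
    with assms have pos: "0 < r + s" by simp
    \<comment> \<open>\<open>z\<close> divides the segment from \<open>a\<close> to \<open>b\<close>
      in the ratio \<open>r : s\<close>, so each centre is at its proportional share of
      \<open>dist a b\<close> from \<open>z\<close>.\<close>
    define z where "z = a + (r / (r + s)) *\<^sub>R (b - a)"
    have "dist a z = r * (dist a b / (r + s))"
      using assms pos by (simp add: z_def dist_norm norm_minus_commute)
    moreover have "b - z = (s / (r + s)) *\<^sub>R (b - a)"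
    proof -
      have eq: "s / (r + s) = 1 - r / (r + s)"
        using pos by (simp add: field_simps)
      show ?thesis unfolding eq by (simp add: z_def scaleR_left_diff_distrib)
    qed
    then have "dist b z = s * (dist a b / (r + s))"
      using assms pos by (simp add: dist_norm norm_minus_commute)
    moreover have "dist a b / (r + s) \<le> 1"
      using le pos by simp
    ultimately have "z \<in> cball a r \<inter> cball b s"
      using assms by (simp only: Int_iff mem_cball mult_left_le)
    then show ?thesis by blast
  qed
qed

lemma dist_vector_2:
  "dist (vector [a, b] :: real ^ 2) (vector [c, d]) = sqrt ((a - c)\<^sup>2 + (b - d)\<^sup>2)"
  by (simp add: dist_vec_def L2_set_def sum_2 dist_real_def)

definition tangent_disk :: "real \<Rightarrow> real \<Rightarrow> (real ^ 2) set" where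
  "tangent_disk p r = cball (vector [p, r]) r"

text \<open>The centres differ by \<open>p - q\<close> horizontally and \<open>r - s\<close>
  vertically, and \<open>4 * r * s\<close> is the difference of the squares of \<open>r + s\<close>
  and \<open>r - s\<close>.\<close>

lemma tangent_disk_Int_nonempty_iff:
  assumes "0 < r" "0 < s"
  shows "tangent_disk p r \<inter> tangent_disk q s \<noteq> {} \<longleftrightarrow> (p - q)\<^sup>2 \<le> 4 * r * s"
proof -
  have "tangent_disk p r \<inter> tangent_disk q s \<noteq> {}
      \<longleftrightarrow> sqrt ((p - q)\<^sup>2 + (r - s)\<^sup>2) \<le> r + s"
    using assms by (simp add: tangent_disk_def cball_Int_cball_nonempty_iff dist_vector_2)
  also have "\<dots> \<longleftrightarrow> (p - q)\<^sup>2 + (r - s)\<^sup>2 \<le> (r + s)\<^sup>2"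
    using assms by (simp add: real_sqrt_le_iff')
  also have "\<dots> \<longleftrightarrow> (p - q)\<^sup>2 \<le> 4 * r * s"
    by (simp add: power2_eq_square algebra_simps)
  finally show ?thesis .
qed

text \<open>The centre has height \<open>r\<close>, so a point of the axis is within distance
  \<open>r\<close> of it only if it lies directly below.\<close>

lemma tangent_disk_axis_iff:
  assumes "0 < r"
  shows "vector [x, 0] \<in> tangent_disk p r \<longleftrightarrow> x = p"
proof -
  have "vector [x, 0] \<in> tangent_disk p r \<longleftrightarrow> sqrt ((p - x)\<^sup>2 + r\<^sup>2) \<le> r"
    by (simp add: tangent_disk_def dist_vector_2)
  also have "\<dots> \<longleftrightarrow> (p - x)\<^sup>2 + r\<^sup>2 \<le> r\<^sup>2"
    using assms by (simp add: real_sqrt_le_iff')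
  finally show ?thesis by auto
qed

lemma tangent_disk_graph_imp_proper_disk_graph:
  assumes "tangent_disk_graph G"
  shows "proper_disk_graph G"
proof -
  from assms obtain p r where fin: "finite (fst G)" and p: "inj_on p (fst G)"
    and r: "\<forall>i\<in>fst G. 0 < r i" and E: "snd G = tangent_edges (fst G) p r"
    unfolding tangent_disk_graph_def by blast
  let ?D = "\<lambda>i. tangent_disk (p i) (r i)"
  have "\<forall>i\<in>fst G. closed_disk (?D i)"
    using r by (auto simp: closed_disk_def tangent_disk_def)
  \<comment> \<open>Containment would put the contact point of disk \<open>i\<close> into disk
    \<open>j\<close>, hence make the two contact points equal, and then \<open>i = j\<close> by
    injectivity of \<open>p\<close>.\<close>
  moreover have "\<forall>i\<in>fst G. \<forall>j\<in>fst G. \<not> ?D i \<subset> ?D j"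
  proof (intro ballI notI)
    fix i j assume ij: "i \<in> fst G" "j \<in> fst G" and sub: "?D i \<subset> ?D j"
    have "vector [p i, 0] \<in> ?D i"
      using ij r by (simp add: tangent_disk_axis_iff)
    with sub have "vector [p i, 0] \<in> ?D j" by blast
    then have "p i = p j"
      using ij r by (simp add: tangent_disk_axis_iff)
    with p ij have "i = j" by (meson inj_onD)
    with sub show False by simp
  qed
  moreover have "G = intersection_graph (fst G) ?D"
  proof -
    have iff: "(p i - p j)\<^sup>2 \<le> 4 * r i * r j \<longleftrightarrow> ?D i \<inter> ?D j \<noteq> {}"
      if "i \<in> fst G" "j \<in> fst G" for i j
      using that r by (simp add: tangent_disk_Int_nonempty_iff)
    have "snd G = {{i, j} | i j. i \<in> fst G \<and> j \<in> fst G \<and> i \<noteq> j \<and> ?D i \<inter> ?D j \<noteq> {}}"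
      unfolding E tangent_edges_def using iff by blast
    then show ?thesis
      unfolding intersection_graph_def by (metis prod.collapse)
  qed
  ultimately show ?thesis
    unfolding proper_disk_graph_def using fin
    by (intro exI[of _ "fst G"] exI[of _ ?D] conjI)
qed

theorem theorem15:
  fixes k :: nat
  assumes "k \<ge> 1"
  shows "proper_disk_graph (BC k)"
  by (intro tangent_disk_graph_imp_proper_disk_graph tangent_disk_graph_BC)

end
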